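(* An argument $\Gamma\rhd\Delta$ is $\{1\}$-symmetric valid if and only if it is classically valid.
   Context: Language: $\mathcal{L}$ is the propositional language with countably infinitely many atomic sentences and connectives $\neg,\lor$ (other classical connectives defined as usual). An argument $\Gamma\rhd\Delta$ is a pair of finite (possibly empty) sets $\Gamma,\Delta$ of sentences of $\mathcal{L}$. A probabilistic model is $\langle W,\mathcal{A},[\![\cdot]\!],P\rangle$ where $W$ is a nonempty set (of worlds); $\mathcal{A}\subseteq\mathcal{P}(W)$ contains $\emptyset$ and is closed under complement in $W$ and binary union; $[\![\cdot]\!]:\mathcal{L}\to\mathcal{A}$ satisfies $[\![\neg\phi]\!]=W\setminus[\![\phi]\!]$ and $[\![\phi\lor\psi]\!]=[\![\phi]\!]\cup[\![\psi]\!]$; and $P:\mathcal{A}\to[0,1]$ is a finitely additive probability ($P(\emptyset)=0$, $P(W\setminus A)=1-P(A)$, and $P(A\cup B)=P(A)+P(B)$ for disjoint $A,B\in\mathcal{A}$). Write $P(\phi)$ for $P([\![\phi]\!])$. For $\alpha\subseteq[0,1]$, its mirror image is $\overline{\alpha}=\{x\in[0,1] : 1-x\in\alpha\}$. $\Gamma\rhd\Delta$ is $\alpha$-symmetric valid iff in every probabilistic model, if $P(\gamma)\in\alpha$ for every $\gamma\in\Gamma$, then $P(\delta)\notin\overline{\alpha}$ for some $\delta\in\Delta$. $\Gamma\rhd\Delta$ is classically valid iff for every probabilistic model and every world $w\in W$, if $w\in[\![\gamma]\!]$ for every $\gamma\in\Gamma$, then $w\in[\![\delta]\!]$ for some $\delta\in\Delta$.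 *)

theory Defs
  imports "HOL-Analysis.Analysis"
begin

datatype sentence = Atom nat | Neg sentence | Disj sentence sentence

text \<open>
  The probability \<open>P\<close> is a total HOL function of which only the values on \<open>A\<close> matter.
  It is only finitely additive, hence not a \<open>prob_space\<close>.  By definition, \<open>algebra W A\<close>
  says that \<open>A\<close> is a family of subsets of \<open>W\<close> that contains the empty set and \<open>W\<close> and is
  closed under union and difference; lemma \<open>algebra_iff_Un\<close> gives the equivalent form
  with complements in \<open>W\<close>.
\<close>

locale prob_model = algebra W A
  for W :: "'w set" and A :: "'w set set" +
  fixes I :: "sentence \<Rightarrow> 'w set" and P :: "'w set \<Rightarrow> real"
  assumes worlds_nonempty: "W \<noteq> {}"
    and interp_in: "I \<phi> \<in> A"
    and interp_Neg: "I (Neg \<phi>) = W - I \<phi>"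
    and interp_Disj: "I (Disj \<phi> \<psi>) = I \<phi> \<union> I \<psi>"
    and prob_range: "X \<in> A \<Longrightarrow> P X \<in> {0..1}"
    and prob_empty: "P {} = 0"
    and prob_compl: "X \<in> A \<Longrightarrow> P (W - X) = 1 - P X"
    and prob_additive: "X \<in> A \<Longrightarrow> Y \<in> A \<Longrightarrow> X \<inter> Y = {} \<Longrightarrow> P (X \<union> Y) = P X + P Y"

definition mirror :: "real set \<Rightarrow> real set" where
  "mirror \<alpha> = {x \<in> {0..1}. 1 - x \<in> \<alpha>}"

text \<open>
  HOL formulas cannot quantify over types, so both notions of validity take the type
  \<open>'w\<close> in which the set of worlds \<open>W\<close> lives as a parameter.
\<close>

definition symmetric_valid ::
  "'w itself \<Rightarrow> real set \<Rightarrow> sentence set \<Rightarrow> sentence set \<Rightarrow> bool" where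
  "symmetric_valid T \<alpha> \<Gamma> \<Delta> \<longleftrightarrow>
    (\<forall>(W :: 'w set) A I P. prob_model W A I P \<longrightarrow>
      (\<forall>\<gamma>\<in>\<Gamma>. P (I \<gamma>) \<in> \<alpha>) \<longrightarrow> (\<exists>\<delta>\<in>\<Delta>. P (I \<delta>) \<notin> mirror \<alpha>))"

definition classically_valid ::
  "'w itself \<Rightarrow> sentence set \<Rightarrow> sentence set \<Rightarrow> bool" where
  "classically_valid T \<Gamma> \<Delta> \<longleftrightarrow>
    (\<forall>(W :: 'w set) A I P. prob_model W A I P \<longrightarrow>
      (\<forall>w\<in>W. (\<forall>\<gamma>\<in>\<Gamma>. w \<in> I \<gamma>) \<longrightarrow> (\<exists>\<delta>\<in>\<Delta>. w \<in> I \<delta>)))"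

end

(* A world of a probabilistic model carries a point-mass probability on the same algebra, under
   which having probability 1 or 0 is truth or falsity at that world. Conversely, if all premises
   have probability 1 and all conclusions probability 0, the worlds that falsify some premise or
   verify some conclusion form a finite union of null sets, so some world lies outside it. *)
theory Submission
  imports Defs
begin

lemma mirror_singleton_1: "mirror {1} = {0}"
  by (auto simp: mirror_def)

context prob_model
begin

lemma prob_world: "P W = 1"
  using prob_compl[of "{}"] prob_empty by simp

text \<open>Cutting \<open>Y\<close> along \<open>X\<close> turns the union into a disjoint one of
  \<open>X\<close> and \<open>Y - X\<close>; the discarded piece \<open>Y \<inter> X\<close> has
  nonnegative probability.\<close>

lemma prob_Un_le:
  assumes X: "X \<in> A" and Y: "Y \<in> A"
  shows "P (X \<union> Y) \<le> P X + P Y"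
proof -
  have split_Un: "P (X \<union> (Y - X)) = P X + P (Y - X)"
    using X Y by (intro prob_additive) auto
  have "P ((Y - X) \<union> (Y \<inter> X)) = P (Y - X) + P (Y \<inter> X)"
    using X Y by (intro prob_additive) auto
  moreover have "(Y - X) \<union> (Y \<inter> X) = Y" by blast
  moreover have "0 \<le> P (Y \<inter> X)"
    using prob_range[of "Y \<inter> X"] X Y by auto
  ultimately show ?thesis using split_Un by simp
qed

text \<open>Each induction step bounds the union by 0 + 0. As \<open>P\<close> is only finitely
  additive, this is where finiteness of the premise and conclusion sets enters.\<close>

lemma prob_Union_null:
  assumes "finite F" and "\<And>X. X \<in> F \<Longrightarrow> X \<in> A \<and> P X = 0"
  shows "P (\<Union>F) = 0"
  using assms
proof (induction F rule: finite_induct)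
  case empty
  then show ?case by (simp add: prob_empty)
next
  case (insert X F)
  have "X \<in> A" and "\<Union>F \<in> A"
    using insert by (auto intro: finite_Union)
  then have "P (X \<union> \<Union>F) \<le> 0" and "0 \<le> P (X \<union> \<Union>F)"
    using prob_Un_le[of X "\<Union>F"] prob_range[of "X \<union> \<Union>F"] insert by auto
  then show ?case by simp
qed

lemma ex_world_certain:
  assumes "finite \<Gamma>" and "finite \<Delta>"
    and "\<And>\<gamma>. \<gamma> \<in> \<Gamma> \<Longrightarrow> P (I \<gamma>) = 1" and "\<And>\<delta>. \<delta> \<in> \<Delta> \<Longrightarrow> P (I \<delta>) = 0"
  shows "\<exists>w\<in>W. (\<forall>\<gamma>\<in>\<Gamma>. w \<in> I \<gamma>) \<and> (\<forall>\<delta>\<in>\<Delta>. w \<notin> I \<delta>)"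
proof -
  define N where "N = \<Union>((\<lambda>\<gamma>. W - I \<gamma>) ` \<Gamma> \<union> I ` \<Delta>)"
  \<comment> \<open>The complement of a premise of probability 1 is null, by
    \<open>prob_compl\<close>, just as each conclusion is.\<close>
  have "P N = 0"
    unfolding N_def using assms interp_in prob_compl by (intro prob_Union_null) auto
  then have "N \<noteq> W"
    using prob_world by auto
  moreover have "N \<subseteq> W"
    unfolding N_def using interp_in sets_into_space by blast
  ultimately obtain w where "w \<in> W" "w \<notin> N"
    by blast
  then show ?thesis
    unfolding N_def by blast
qed

text \<open>Exactly one of \<open>X\<close> and \<open>W - X\<close> contains \<open>w\<close>, and
  at most one of two disjoint sets does. Keeping \<open>W\<close>, \<open>A\<close> and
  \<open>I\<close> makes truth at \<open>w\<close> in the given model the same as probability 1 in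
  the new one.\<close>

lemma prob_model_point_mass:
  assumes "w \<in> W"
  shows "prob_model W A I (\<lambda>X. indicator X w)"
  using assms worlds_nonempty interp_in interp_Neg interp_Disj
  by unfold_locales (auto simp: indicator_def)

end

theorem fact40:
  fixes \<Gamma> \<Delta> :: "sentence set"
  assumes "finite \<Gamma>" and "finite \<Delta>"
  shows "symmetric_valid TYPE('w) {1} \<Gamma> \<Delta> \<longleftrightarrow> classically_valid TYPE('w) \<Gamma> \<Delta>"
proof
  assume valid: "symmetric_valid TYPE('w) {1} \<Gamma> \<Delta>"
  show "classically_valid TYPE('w) \<Gamma> \<Delta>"
    unfolding classically_valid_def
  proof (intro allI impI ballI)
    fix W :: "'w set" and A I P w
    assume "prob_model W A I P" and "w \<in> W" and true_at: "\<forall>\<gamma>\<in>\<Gamma>. w \<in> I \<gamma>"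
    then have "prob_model W A I (\<lambda>X. indicator X w)"
      by (intro prob_model.prob_model_point_mass)
    moreover have "\<forall>\<gamma>\<in>\<Gamma>. indicator (I \<gamma>) w \<in> {1 :: real}"
      using true_at by simp
    ultimately obtain \<delta> where "\<delta> \<in> \<Delta>" and "indicator (I \<delta>) w \<notin> mirror {1}"
      using valid unfolding symmetric_valid_def by blast
    \<comment> \<open>An indicator that is not 0 is 1, so this conclusion is true at
      \<open>w\<close>.\<close>
    then show "\<exists>\<delta>\<in>\<Delta>. w \<in> I \<delta>"
      by (auto simp: mirror_singleton_1 indicator_def split: if_splits)
  qed
next
  assume valid: "classically_valid TYPE('w) \<Gamma> \<Delta>"
  show "symmetric_valid TYPE('w) {1} \<Gamma> \<Delta>"
    unfolding symmetric_valid_def mirror_singleton_1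
  \<comment> \<open>With the mirror image rewritten to \<open>{0}\<close>, the negated goal says
    that every conclusion has probability 0, as \<open>ex_world_certain\<close> requires.\<close>
  proof (intro allI impI, rule ccontr)
    fix W :: "'w set" and A I P
    assume model: "prob_model W A I P"
      and "\<forall>\<gamma>\<in>\<Gamma>. P (I \<gamma>) \<in> {1}" and "\<not> (\<exists>\<delta>\<in>\<Delta>. P (I \<delta>) \<notin> {0})"
    then have "\<exists>w\<in>W. (\<forall>\<gamma>\<in>\<Gamma>. w \<in> I \<gamma>) \<and> (\<forall>\<delta>\<in>\<Delta>. w \<notin> I \<delta>)"
      using assms by (intro prob_model.ex_world_certain[OF model]) auto
    then show False
      using valid model unfolding classically_valid_def by blast
  qed
qed

end
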